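(* Let $\mathcal N=(D,s,t)$ be a network with $D=(V,E)$ a finite directed graph. Let $\mathcal P_1,\ldots,\mathcal P_m$ be sets of $s$–$t$ paths in $D$ such that, for each $i$, the paths in $\mathcal P_i$ are pairwise innerly disjoint, and let $\mathcal P$ be the multiset union $\mathcal P_1\cup\cdots\cup\mathcal P_m$ (so $|\mathcal P|=\sum_{i=1}^m|\mathcal P_i|$). Let $\mathcal L=(\mathcal P_1,\ldots,\mathcal P_m)$. Then $|R(\mathcal L)|>|\mathcal P|$.
   Context: A network is a triple $(D,s,t)$ where $D=(V,E)$ is a directed graph and $s,t\in V$ are distinct vertices (source and sink) such that no edge of $D$ enters $s$ and no edge of $D$ leaves $t$. Paths are directed paths without repeated vertices; for a path $P$, $V(P)$ and $E(P)$ denote its vertex and edge sets. For an $s$–$t$ path $P$, $V^\circ(P)=V(P)\setminus\{s,t\}$; two $s$–$t$ paths $P,Q$ are innerly disjoint if $V^\circ(P)\cap V^\circ(Q)=\emptyset$. For a set $\mathcal P_i$ of paths, $E[\mathcal P_i]=\bigcup_{P\in\mathcal P_i}E(P)$. A path $Q$ in $D$ is $\mathcal L$-multicolored if there is an injective map $\psi:E(Q)\to\{1,\ldots,m\}$ with $e\in E[\mathcal P_{\psi(e)}]$ for every $e\in E(Q)$ (i.e. each edge of $Q$ lies on a path from a different $\mathcal P_i$). A vertex $v$ is reachable if there is an $\mathcal L$-multicolored path from $s$ to $v$ (the one-vertex path at $s$ counts, so $s$ is always reachable). $R(\mathcal L)$ denotes the set of reachable vertices.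
   Formalization: The formal theorem additionally assumes that the sink t is not reachable (no multicolored s–t path); without this the claim fails, e.g. for a single edge from s to t with P_1 = P_2 consisting of that edge, where |R(L)| = 2 = |P|. *)

theory Defs
  imports "Graph_Theory.Graph_Theory" "HOL-Library.Multiset"
begin

text \<open>
  The locale \<^locale>\<open>fin_digraph\<close> permits loops and parallel arcs, so digraphs whose arcs are
  ordered pairs of vertices are included.
\<close>

locale network = fin_digraph D for D :: "('v, 'e) pre_digraph" +
  fixes s t :: 'v
  assumes source_in_verts: "s \<in> verts D"
    and sink_in_verts: "t \<in> verts D"
    and source_neq_sink: "s \<noteq> t"
    and no_arc_enters_source: "e \<in> arcs D \<Longrightarrow> head D e \<noteq> s"
    and no_arc_leaves_sink: "e \<in> arcs D \<Longrightarrow> tail D e \<noteq> t"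

text \<open>
  A path is given by its list of arcs, so its arc set is \<^term>\<open>set p\<close>; together with its
  start vertex the list determines the sequence of vertices.  The empty list is the one-vertex path.
\<close>

definition st_path :: "('v, 'e) pre_digraph \<Rightarrow> 'v \<Rightarrow> 'v \<Rightarrow> 'e awalk \<Rightarrow> bool" where
  "st_path D s t p \<longleftrightarrow> pre_digraph.apath D s p t"

definition inner_verts :: "('v, 'e) pre_digraph \<Rightarrow> 'v \<Rightarrow> 'v \<Rightarrow> 'e awalk \<Rightarrow> 'v set" where
  "inner_verts D s t p = set (pre_digraph.awalk_verts D s p) - {s, t}"

definition innerly_disjoint ::
  "('v, 'e) pre_digraph \<Rightarrow> 'v \<Rightarrow> 'v \<Rightarrow> 'e awalk \<Rightarrow> 'e awalk \<Rightarrow> bool" where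
  "innerly_disjoint D s t p q \<longleftrightarrow> inner_verts D s t p \<inter> inner_verts D s t q = {}"

definition edges_of :: "'e awalk set \<Rightarrow> 'e set" where
  "edges_of Q = (\<Union>p\<in>Q. set p)"

text \<open>
  A sequence of \<open>m\<close> sets of paths is a function \<open>Ps\<close> of which only the values at
  \<open>1, \<dots>, m\<close> matter.
\<close>

definition multicolored :: "nat \<Rightarrow> (nat \<Rightarrow> 'e awalk set) \<Rightarrow> 'e awalk \<Rightarrow> bool" where
  "multicolored m Ps q \<longleftrightarrow>
     (\<exists>\<psi>. inj_on \<psi> (set q) \<and> \<psi> ` set q \<subseteq> {1..m} \<and> (\<forall>e\<in>set q. e \<in> edges_of (Ps (\<psi> e))))"

definition reachable_set ::
  "('v, 'e) pre_digraph \<Rightarrow> 'v \<Rightarrow> nat \<Rightarrow> (nat \<Rightarrow> 'e awalk set) \<Rightarrow> 'v set" where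
  "reachable_set D s m Ps = {v. \<exists>q. pre_digraph.apath D s q v \<and> multicolored m Ps q}"

definition multiset_union :: "nat \<Rightarrow> (nat \<Rightarrow> 'a set) \<Rightarrow> 'a multiset" where
  "multiset_union m Ps = (\<Sum>i\<in>{1..m}. mset_set (Ps i))"

text \<open>
  The bound \<open>|R| > |P|\<close> concerns the case where the sink is not reachable.  If the sink is
  reachable it can fail, since nothing limits the number of path sets: in the network with a single
  arc, from source to sink, let two path sets both consist of that arc.
\<close>

lemma bound_fails_if_sink_reachable:
  defines "D \<equiv> \<lparr>verts = {0, 1}, arcs = {()}, tail = \<lambda>_. 0, head = \<lambda>_. 1\<rparr> :: (nat, unit) pre_digraph"
    and "Ps \<equiv> (\<lambda>i. {[()]}) :: nat \<Rightarrow> unit awalk set"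
  shows "network D 0 1"
    and "\<forall>i\<in>{1..2}. \<forall>p\<in>Ps i. st_path D 0 1 p"
    and "\<forall>i\<in>{1..2}. pairwise (innerly_disjoint D 0 1) (Ps i)"
    and "1 \<in> reachable_set D 0 2 Ps"
    and "\<not> card (reachable_set D 0 2 Ps) > size (multiset_union 2 Ps)"
proof -
  show N: "network D 0 1"
    by unfold_locales (auto simp: D_def)
  interpret network D 0 1 by (fact N)
  have path: "apath 0 [()] 1"
    by (simp add: apath_def awalk_def) (simp add: D_def)
  show "\<forall>i\<in>{1..2}. \<forall>p\<in>Ps i. st_path D 0 1 p"
    using path by (simp add: Ps_def st_path_def)
  show "\<forall>i\<in>{1..2}. pairwise (innerly_disjoint D 0 1) (Ps i)"
    by (simp add: Ps_def)
  have "multicolored 2 Ps [()]"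
    unfolding multicolored_def by (rule exI[of _ "\<lambda>_. 1"]) (auto simp: Ps_def edges_of_def)
  with path show "1 \<in> reachable_set D 0 2 Ps"
    by (auto simp: reachable_set_def)
  have "reachable_set D 0 2 Ps \<subseteq> verts D"
    by (auto simp: reachable_set_def apath_def dest: awalk_last_in_verts)
  then have "card (reachable_set D 0 2 Ps) \<le> card (verts D)"
    by (intro card_mono) auto
  also have "card (verts D) = 2" by (simp add: D_def)
  finally show "\<not> card (reachable_set D 0 2 Ps) > size (multiset_union 2 Ps)"
    by (simp add: multiset_union_def Ps_def numeral_2_eq_2)
qed

end

(* Adding the path sets one at a time, with R the set reached so far: every path of the next set P_i
   leads from s, which lies in R, to t, which does not, so it has an arc leaving R.  Its head is newly
   reached, because a multicolored path to its tail stays inside R and can be prolonged by this arc in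
   the new color i.  The heads obtained from different paths of P_i are inner vertices and hence
   distinct, so R grows by at least |P_i|; initially R = {s}. *)

theory Submission
  imports Defs
begin

text \<open>The same coloring serves. This is used with \<open>q' = q\<close> to compare different
  \<open>m\<close>, and with \<open>q'\<close> an initial segment of \<open>q\<close> to cut a path
  short.\<close>

lemma multicolored_mono:
  assumes "multicolored m Ps q" and "set q' \<subseteq> set q" and "m \<le> n"
  shows "multicolored n Ps q'"
proof -
  obtain \<psi> where \<psi>: "inj_on \<psi> (set q)" "\<psi> ` set q \<subseteq> {1..m}"
    "\<forall>e\<in>set q. e \<in> edges_of (Ps (\<psi> e))"
    using assms(1) by (auto simp: multicolored_def)
  have "\<psi> ` set q' \<subseteq> {1..n}"
    using \<psi>(2) assms(2,3) by fastforce
  with \<psi> assms(2) show ?thesis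
    unfolding multicolored_def by (blast intro: inj_on_subset)
qed

text \<open>The color \<open>Suc m\<close> is free because \<open>\<psi>\<close> takes values in
  \<open>{1..m}\<close>; as \<open>e\<close> is not on \<open>q\<close>, giving it this color
  changes no earlier one.\<close>

lemma multicolored_snoc:
  assumes "multicolored m Ps q" and "e \<in> edges_of (Ps (Suc m))" and "e \<notin> set q"
  shows "multicolored (Suc m) Ps (q @ [e])"
proof -
  obtain \<psi> where \<psi>: "inj_on \<psi> (set q)" "\<psi> ` set q \<subseteq> {1..m}"
    "\<forall>x\<in>set q. x \<in> edges_of (Ps (\<psi> x))"
    using assms(1) by (auto simp: multicolored_def)
  have "inj_on (\<psi>(e := Suc m)) (insert e (set q))"
  proof -
    have "Suc m \<notin> \<psi> ` set q" using \<psi>(2) by auto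
    then have "inj_on (\<psi>(e := Suc m)) (set q)"
      using \<psi>(1) by (rule inj_on_fun_updI[rotated])
    with \<open>Suc m \<notin> \<psi> ` set q\<close> assms(3) show ?thesis by auto
  qed
  moreover have "(\<psi>(e := Suc m)) ` insert e (set q) \<subseteq> {1..Suc m}"
    using \<psi>(2) by fastforce
  ultimately show ?thesis
    using \<psi>(3) assms(2) unfolding multicolored_def
    by (intro exI[of _ "\<psi>(e := Suc m)"]) auto
qed

lemma multicolored_0_iff: "multicolored 0 Ps q \<longleftrightarrow> q = []"
  by (auto simp: multicolored_def)

context wf_digraph
begin

text \<open>Either the first arc leaves \<open>S\<close>, or its head lies in \<open>S\<close> again
  and the rest of the walk is a shorter instance.\<close>

lemma awalk_leaves_set:
  assumes "awalk u p v" and "u \<in> S" and "v \<notin> S"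
  obtains e where "e \<in> set p" "tail G e \<in> S" "head G e \<notin> S"
proof -
  from assms have "\<exists>e\<in>set p. tail G e \<in> S \<and> head G e \<notin> S"
    by (induction p arbitrary: u) (auto simp: awalk_simps)
  then show ?thesis using that by blast
qed

lemma apath_snocI:
  assumes "apath u q (tail G e)" and "e \<in> arcs G" and "head G e \<notin> set (awalk_verts u q)"
  shows "apath u (q @ [e]) (head G e)"
proof -
  have "awalk u (q @ [e]) (head G e)"
    using awalk_appendI[OF awalkI_apath[OF assms(1)] arc_implies_awalk[OF assms(2)]] .
  moreover from assms(1) have "awlast u q = tail G e"
    by (auto simp: apath_def)
  ultimately show ?thesis
    using assms by (auto simp: apath_def awalk_verts_append)
qed

lemma reachable_set_subset_verts: "reachable_set G u m Ps \<subseteq> verts G"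
  by (auto simp: reachable_set_def apath_def dest: awalk_last_in_verts)

lemma reachable_set_0:
  assumes "u \<in> verts G"
  shows "reachable_set G u 0 Ps = {u}"
  using assms by (auto simp: reachable_set_def multicolored_0_iff apath_Nil_iff)

lemma reachable_set_mono:
  assumes "m \<le> n"
  shows "reachable_set G u m Ps \<subseteq> reachable_set G u n Ps"
  using assms by (auto simp: reachable_set_def intro: multicolored_mono)

text \<open>Cutting \<open>q\<close> at one of its vertices leaves an initial segment that is again
  a path and inherits the coloring.\<close>

lemma awalk_verts_subset_reachable_set:
  assumes "apath u q v" and "multicolored m Ps q"
  shows "set (awalk_verts u q) \<subseteq> reachable_set G u m Ps"
proof
  fix w assume "w \<in> set (awalk_verts u q)"
  then obtain q1 q2 where q: "q = q1 @ q2" "awalk u q1 w"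
    using awalk_decomp assms(1) by (blast dest: awalkI_apath)
  then have "apath u q1 w"
    using assms(1) by (auto simp: apath_append_iff)
  moreover have "multicolored m Ps q1"
    using assms(2) q(1) by (auto intro: multicolored_mono)
  ultimately show "w \<in> reachable_set G u m Ps"
    by (auto simp: reachable_set_def)
qed

lemma head_in_reachable_set_Suc:
  assumes "e \<in> arcs G" and "e \<in> edges_of (Ps (Suc m))"
    and "tail G e \<in> reachable_set G u m Ps" and "head G e \<notin> reachable_set G u m Ps"
  shows "head G e \<in> reachable_set G u (Suc m) Ps"
proof -
  obtain q where q: "apath u q (tail G e)" "multicolored m Ps q"
    using assms(3) by (auto simp: reachable_set_def)
  then have notin: "head G e \<notin> set (awalk_verts u q)"
    using awalk_verts_subset_reachable_set assms(4) by blast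
  \<comment> \<open>An arc of \<open>q\<close> would have its head among the vertices of
    \<open>q\<close>.\<close>
  then have "e \<notin> set q"
    using q(1) awalk_verts_arc2 by (blast dest: awalkI_apath)
  with q notin assms(1,2) show ?thesis
    by (auto simp: reachable_set_def intro: apath_snocI multicolored_snoc)
qed

end

text \<open>Unreachability of \<open>t\<close> is assumed at stage \<open>Suc m\<close> because it
  serves twice: it forces each path to leave the old reachable set, and it keeps the newly reached
  head different from \<open>t\<close>.\<close>

lemma (in network) card_paths_le_newly_reached:
  assumes paths: "\<And>p. p \<in> Ps (Suc m) \<Longrightarrow> st_path D s t p"
    and disj: "pairwise (innerly_disjoint D s t) (Ps (Suc m))"
    and t: "t \<notin> reachable_set D s (Suc m) Ps"
  shows "card (Ps (Suc m)) \<le> card (reachable_set D s (Suc m) Ps - reachable_set D s m Ps)"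
proof -
  let ?R = "reachable_set D s m Ps" and ?R' = "reachable_set D s (Suc m) Ps"
  have sub: "?R \<subseteq> ?R'" by (rule reachable_set_mono) simp
  have s: "s \<in> ?R"
    using reachable_set_mono[of 0 m] reachable_set_0[OF source_in_verts] by blast
  have "\<exists>w. w \<in> Defs.inner_verts D s t p \<and> w \<in> ?R' - ?R" if p: "p \<in> Ps (Suc m)" for p
  proof -
    have walk: "awalk s p t"
      using paths[OF p] by (auto simp: st_path_def apath_def)
    then obtain e where e: "e \<in> set p" "tail D e \<in> ?R" "head D e \<notin> ?R"
      using s t sub by (blast elim: awalk_leaves_set)
    have "e \<in> arcs D" using walk e(1) by blast
    moreover have "e \<in> edges_of (Ps (Suc m))"
      using p e(1) by (auto simp: edges_of_def)
    ultimately have "head D e \<in> ?R'"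
      using e by (intro head_in_reachable_set_Suc)
    \<comment> \<open>The head is not \<open>s\<close>, which lies in \<open>?R\<close>, and not
      \<open>t\<close>, which lies outside \<open>?R'\<close>.\<close>
    moreover from this have "head D e \<in> Defs.inner_verts D s t p"
      using awalk_verts_arc2[OF walk e(1)] s e(3) t by (auto simp: Defs.inner_verts_def)
    ultimately show ?thesis using e(3) by blast
  qed
  then obtain f where f: "\<And>p. p \<in> Ps (Suc m) \<Longrightarrow> f p \<in> Defs.inner_verts D s t p \<and> f p \<in> ?R' - ?R"
    by metis
  \<comment> \<open>A common value of \<open>f\<close> would be an inner vertex shared by two
    distinct paths.\<close>
  have "inj_on f (Ps (Suc m))"
  proof (rule inj_onI, rule ccontr)
    fix p q assume "p \<in> Ps (Suc m)" "q \<in> Ps (Suc m)" "f p = f q" "p \<noteq> q"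
    then show False
      using f[of p] f[of q] pairwiseD[OF disj, of p q] by (auto simp: innerly_disjoint_def)
  qed
  moreover have "finite (?R' - ?R)"
    by (intro finite_Diff finite_subset[OF reachable_set_subset_verts]) simp
  ultimately show ?thesis
    using f by (intro card_inj_on_le) auto
qed

theorem theorem2p1:
  fixes D :: "('v, 'e) pre_digraph" and s t :: 'v
    and m :: nat and Ps :: "nat \<Rightarrow> 'e awalk set"
  assumes "network D s t"
    and "\<And>i p. i \<in> {1..m} \<Longrightarrow> p \<in> Ps i \<Longrightarrow> st_path D s t p"
    and "\<And>i. i \<in> {1..m} \<Longrightarrow> pairwise (innerly_disjoint D s t) (Ps i)"
    and "t \<notin> reachable_set D s m Ps"
  shows "card (reachable_set D s m Ps) > size (multiset_union m Ps)"
  using assms(2-)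
proof (induction m)
  interpret network D s t by (fact assms(1))
  case 0
  \<comment> \<open>Strictness originates here, as the empty union is compared with the singleton of
    \<open>s\<close>; the later steps only preserve it.\<close>
  show ?case
    by (simp add: multiset_union_def reachable_set_0[OF source_in_verts])
next
  interpret network D s t by (fact assms(1))
  case (Suc m)
  let ?R = "reachable_set D s m Ps" and ?R' = "reachable_set D s (Suc m) Ps"
  have sub: "?R \<subseteq> ?R'" by (rule reachable_set_mono) simp
  have fin: "finite ?R'"
    by (rule finite_subset[OF reachable_set_subset_verts]) simp
  have IH: "size (multiset_union m Ps) < card ?R"
  proof (rule Suc.IH)
    show "st_path D s t p" if "i \<in> {1..m}" "p \<in> Ps i" for i p
      using that by (intro Suc.prems(1)[of i]) auto
    show "pairwise (innerly_disjoint D s t) (Ps i)" if "i \<in> {1..m}" for i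
      using that by (intro Suc.prems(2)) auto
    \<comment> \<open>Unreachability passes down to fewer path sets, since reachable sets grow with
      \<open>m\<close>.\<close>
    show "t \<notin> ?R" using Suc.prems(3) sub by blast
  qed
  have "size (multiset_union (Suc m) Ps) = size (multiset_union m Ps) + card (Ps (Suc m))"
    by (simp add: multiset_union_def)
  also have "\<dots> < card ?R + card (?R' - ?R)"
    using IH card_paths_le_newly_reached[of Ps m] Suc.prems by fastforce
  also have "\<dots> = card ?R'"
    using sub fin by (simp add: card_Diff_subset card_mono finite_subset)
  finally show ?case .
qed

end
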